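(* Let $Q\in\mathbb{R}^{\ell\times\ell}$ be a (not necessarily symmetric) matrix with $Q^T+Q\succ 0$, and let $D\in\mathbb{R}^{\ell\times\ell}$ be a symmetric matrix with $$0\prec D\prec Q^T+Q .$$ Then, for matrices $H,M\in\mathbb{R}^{\ell\times\ell}$, $$HM=Q \ \text{ and }\ M^THM=D \quad\Longleftrightarrow\quad H=QD^{-1}Q^T\ \text{ and }\ M=Q^{-T}D .$$ In particular $H$ and $M$ are uniquely determined by $Q$ and $D$. Moreover, with $H=QD^{-1}Q^T$ and $M=Q^{-T}D$, the matrix $M$ is nonsingular and the following hold: $H\succ 0$, $HM=Q$, and $$G:=Q^T+Q-M^THM=Q^T+Q-D\succ 0 .$$
   Context: For real square matrices of the same size, $A\succ 0$ means that $A$ is symmetric and positive definite, and $A\prec B$ means that $B-A\succ 0$. $Q^{-T}$ denotes $(Q^T)^{-1}$. *)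

theory Defs
  imports "HOL-Analysis.Analysis"
begin

text \<open>Positive definiteness includes symmetry, which does not follow from positivity of the
  quadratic form over the reals.\<close>

definition pos_def :: "real ^ 'n ^ 'n \<Rightarrow> bool" where
  "pos_def A \<longleftrightarrow> transpose A = A \<and> (\<forall>x. x \<noteq> 0 \<longrightarrow> 0 < x \<bullet> (A *v x))"

definition loewner_less :: "real ^ 'n ^ 'n \<Rightarrow> real ^ 'n ^ 'n \<Rightarrow> bool" where
  "loewner_less A B \<longleftrightarrow> pos_def (B - A)"

end

theory Submission
  imports Defs
begin

text \<open>Everything rests on \<open>Q\<close> and \<open>D\<close> being nonsingular. For \<open>D\<close> this is definiteness; for \<open>Q\<close> it
  holds because \<open>x \<bullet> Q x\<close> is half the value at \<open>x\<close> of the quadratic form of \<open>Q\<^sup>T + Q\<close>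
  (lemma \<open>invertible_if_symmetric_part_pos_def\<close>).

  Given nonsingularity, the two equations can be solved one after the other. Substituting \<open>H M = Q\<close>
  into \<open>M\<^sup>T H M = D\<close> leaves \<open>M\<^sup>T Q = D\<close>, whose transpose \<open>Q\<^sup>T M = D\<close> is linear in \<open>M\<close>; its solution
  \<open>M\<close> is a product of nonsingular matrices, so \<open>H M = Q\<close> then determines \<open>H\<close>. Conversely, the
  resulting matrices are seen to solve the equations by cancelling inverses
  (lemma \<open>factorization_iff\<close>).

  Finally, \<open>H = (Q D\<^sup>-\<^sup>1) D (Q D\<^sup>-\<^sup>1)\<^sup>T\<close> is congruent to \<open>D\<close>, hence positive definite, and
  \<open>G = Q\<^sup>T + Q - D\<close> is positive definite by the assumed upper bound on \<open>D\<close>.\<close>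

lemma matrix_inv_mult:
  fixes A :: "real ^ 'n ^ 'n"
  assumes "invertible A"
  shows "A ** matrix_inv A = mat 1" and "matrix_inv A ** A = mat 1"
proof -
  have "A ** matrix_inv A = mat 1 \<and> matrix_inv A ** A = mat 1"
    using assms unfolding invertible_def matrix_inv_def by (rule someI_ex)
  then show "A ** matrix_inv A = mat 1" and "matrix_inv A ** A = mat 1"
    by simp_all
qed

lemma invertible_matrix_inv:
  fixes A :: "real ^ 'n ^ 'n"
  assumes "invertible A"
  shows "invertible (matrix_inv A)"
  using matrix_inv_mult[OF assms] unfolding invertible_def by blast

lemma matrix_inv_mult_cancel:
  fixes A B :: "real ^ 'n ^ 'n"
  assumes "invertible A"
  shows "A ** (matrix_inv A ** B) = B" and "matrix_inv A ** (A ** B) = B"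
  by (simp_all add: matrix_mul_assoc matrix_inv_mult[OF assms])

lemma transpose_matrix_inv:
  fixes A :: "real ^ 'n ^ 'n"
  assumes "invertible A"
  shows "transpose (matrix_inv A) = matrix_inv (transpose A)"
proof -
  have "transpose (matrix_inv A) ** transpose A = mat 1"
    by (metis assms matrix_inv_mult(1) matrix_transpose_mul transpose_mat)
  then show ?thesis
    by (metis assms transpose_invertible matrix_inv_mult(1) matrix_mul_assoc matrix_mul_lid
        matrix_mul_rid)
qed

lemma invertible_if_quadratic_form_pos:
  fixes A :: "real ^ 'n ^ 'n"
  assumes "\<And>x. x \<noteq> 0 \<Longrightarrow> 0 < x \<bullet> (A *v x)"
  shows "invertible A"
proof -
  have "x = 0" if "A *v x = 0" for x
    using assms[of x] that by force
  then show ?thesis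
    unfolding invertible_left_inverse matrix_left_invertible_ker by blast
qed

lemma invertible_if_symmetric_part_pos_def:
  fixes Q :: "real ^ 'n ^ 'n"
  assumes "pos_def (transpose Q + Q)"
  shows "invertible Q"
proof (rule invertible_if_quadratic_form_pos)
  fix x :: "real ^ 'n"
  assume "x \<noteq> 0"
  have "x \<bullet> ((transpose Q + Q) *v x) = 2 * (x \<bullet> (Q *v x))"
    by (simp add: matrix_vector_mult_add_rdistrib inner_add_right dot_lmul_matrix
        inner_commute[of x "x v* Q"])
  then show "0 < x \<bullet> (Q *v x)"
    using assms \<open>x \<noteq> 0\<close> unfolding pos_def_def by fastforce
qed

lemma pos_def_invertible: "pos_def A \<Longrightarrow> invertible A"
  by (rule invertible_if_quadratic_form_pos) (simp add: pos_def_def)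

text \<open>A congruence is a change of variables in the quadratic form, and nonsingularity of \<open>B\<close> keeps
  the new variable \<open>B\<^sup>T x\<close> away from zero.\<close>

lemma pos_def_congruence:
  fixes A B :: "real ^ 'n ^ 'n"
  assumes A: "pos_def A" and B: "invertible B"
  shows "pos_def (B ** A ** transpose B)"
  unfolding pos_def_def
proof (intro conjI allI impI)
  show "transpose (B ** A ** transpose B) = B ** A ** transpose B"
    using A by (simp add: pos_def_def matrix_transpose_mul matrix_mul_assoc)
next
  fix x :: "real ^ 'n"
  assume "x \<noteq> 0"
  define y where "y = transpose B *v x"
  have "y \<noteq> 0"
  proof
    assume "y = 0"
    moreover have "\<exists>C. C ** transpose B = mat 1"
      using B transpose_invertible invertible_left_inverse by blast
    ultimately show False
      using \<open>x \<noteq> 0\<close> unfolding matrix_left_invertible_ker y_def by blast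
  qed
  have "x \<bullet> ((B ** A ** transpose B) *v x) = y \<bullet> (A *v y)"
    by (simp add: y_def dot_lmul_matrix flip: matrix_vector_mul_assoc)
  with \<open>y \<noteq> 0\<close> A show "0 < x \<bullet> ((B ** A ** transpose B) *v x)"
    by (simp add: pos_def_def)
qed

lemma factorization_iff:
  fixes Q D H M :: "real ^ 'n ^ 'n"
  assumes Q: "invertible Q" and D: "invertible D" and sym: "transpose D = D"
  shows "H ** M = Q \<and> transpose M ** H ** M = D \<longleftrightarrow>
         H = Q ** matrix_inv D ** transpose Q \<and> M = matrix_inv (transpose Q) ** D"
proof -
  note QT = transpose_invertible[OF Q]
  note cancel = matrix_inv_mult_cancel[OF Q] matrix_inv_mult_cancel[OF D]
    matrix_inv_mult_cancel[OF QT] matrix_inv_mult[OF Q] matrix_inv_mult[OF D] matrix_inv_mult[OF QT]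
  show ?thesis
  proof (intro iffI conjI)
    assume eqs: "H ** M = Q \<and> transpose M ** H ** M = D"
    then have "transpose M ** Q = D"
      by (metis matrix_mul_assoc)
    then have "transpose Q ** M = D"
      by (metis sym matrix_transpose_mul transpose_transpose)
    then show M: "M = matrix_inv (transpose Q) ** D"
      by (metis cancel(6))
    have "H ** (M ** (matrix_inv D ** transpose Q)) = Q ** matrix_inv D ** transpose Q"
      using eqs by (metis matrix_mul_assoc)
    moreover have "M ** (matrix_inv D ** transpose Q) = mat 1"
      by (simp add: M cancel flip: matrix_mul_assoc)
    ultimately show "H = Q ** matrix_inv D ** transpose Q"
      by simp
  next
    assume sol: "H = Q ** matrix_inv D ** transpose Q \<and> M = matrix_inv (transpose Q) ** D"
    then show HM: "H ** M = Q"
      by (simp add: cancel flip: matrix_mul_assoc)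
    have "transpose M = D ** matrix_inv Q"
      using sol by (simp add: matrix_transpose_mul sym transpose_matrix_inv[OF QT])
    then show "transpose M ** H ** M = D"
      by (simp add: HM cancel flip: matrix_mul_assoc)
  qed
qed

theorem mainTheorem1:
  fixes Q D :: "real ^ 'l ^ 'l"
  assumes "pos_def (transpose Q + Q)"
    and "transpose D = D"
    and "pos_def D"
    and "loewner_less D (transpose Q + Q)"
  shows "(\<forall>H M :: real ^ 'l ^ 'l.
            (H ** M = Q \<and> transpose M ** H ** M = D) \<longleftrightarrow>
            (H = Q ** matrix_inv D ** transpose Q \<and> M = matrix_inv (transpose Q) ** D)) \<and>
         (\<exists>!p :: (real ^ 'l ^ 'l) \<times> (real ^ 'l ^ 'l).
            case p of (H, M) \<Rightarrow> H ** M = Q \<and> transpose M ** H ** M = D) \<and>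
         (let H = Q ** matrix_inv D ** transpose Q;
              M = matrix_inv (transpose Q) ** D;
              G = transpose Q + Q - transpose M ** H ** M
          in invertible M \<and> pos_def H \<and> H ** M = Q \<and>
             G = transpose Q + Q - D \<and> pos_def G)"
proof -
  let ?H = "Q ** matrix_inv D ** transpose Q"
  let ?M = "matrix_inv (transpose Q) ** D"
  note Q = invertible_if_symmetric_part_pos_def[OF assms(1)]
  note D = pos_def_invertible[OF assms(3)]
  note iff = factorization_iff[OF Q D assms(2)]
  have eqs: "?H ** ?M = Q" "transpose ?M ** ?H ** ?M = D"
    using iff[of ?H ?M] by simp_all
  have unique: "\<exists>!p :: (real ^ 'l ^ 'l) \<times> (real ^ 'l ^ 'l).
      case p of (H, M) \<Rightarrow> H ** M = Q \<and> transpose M ** H ** M = D"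
    by (rule ex1I[of _ "(?H, ?M)"]) (auto simp: iff)
  have M: "invertible ?M"
    by (intro invertible_mult invertible_matrix_inv transpose_invertible Q D)
  have "pos_def ((Q ** matrix_inv D) ** D ** transpose (Q ** matrix_inv D))"
    by (intro pos_def_congruence assms(3) invertible_mult invertible_matrix_inv Q D)
  also have "(Q ** matrix_inv D) ** D ** transpose (Q ** matrix_inv D) = ?H"
    by (simp add: matrix_transpose_mul transpose_matrix_inv[OF D] assms(2)
        matrix_inv_mult_cancel[OF D] flip: matrix_mul_assoc)
  finally have H: "pos_def ?H" .
  have "pos_def (transpose Q + Q - D)"
    using assms(4) by (simp add: loewner_less_def)
  then show ?thesis
    unfolding Let_def eqs using iff unique M H by blast
qed

end
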